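(* Let $m\ge1$ and let $n_i,k_i,l_i\ge 1$ be integers for $i=1,\dots,m$. (Invariant case.) The real vector space of invariant linear maps $L:\mathbb{R}^{n_1^{k_1}\times n_2^{k_2}\times\cdots\times n_m^{k_m}}\to\mathbb{R}$ has dimension $\prod_{i=1}^m\mathrm{b}(k_i)$. An orthogonal basis is given by the tensors $B^{\lambda_1,\dots,\lambda_m}$, $\lambda_i\in[n_i]^{k_i}/_\sim$, where for $a_i\in[n_i]^{k_i}$ $$B^{\lambda_1,\dots,\lambda_m}_{a_1,\dots,a_m}=\begin{cases}1& a_i\in\lambda_i\ \text{for all } i\\0&\text{otherwise.}\end{cases}$$ (Equivariant case.) The real vector space of equivariant linear maps $L:\mathbb{R}^{n_1^{k_1}\times\cdots\times n_m^{k_m}}\to\mathbb{R}^{n_1^{l_1}\times\cdots\times n_m^{l_m}}$ has dimension $\prod_{i=1}^m\mathrm{b}(k_i+l_i)$. An orthogonal basis is given by the tensors $B^{\mu_1,\dots,\mu_m}$, $\mu_i\in[n_i]^{k_i+l_i}/_\sim$, where for $a_i\in[n_i]^{k_i}$, $b_i\in[n_i]^{l_i}$ $$B^{\mu_1,\dots,\mu_m}_{a_1,\dots,a_m,b_1,\dots,b_m}=\begin{cases}1& (a_i,b_i)\in\mu_i\ \text{for all } i\\0&\text{otherwise.}\end{cases}$$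
   Context: $[n]=\{1,\dots,n\}$. $\mathbb{R}^{n_1^{k_1}\times\cdots\times n_m^{k_m}}$ is the space of real tensors $A=(A_{a_1,\dots,a_m})$ indexed by $a_i\in[n_i]^{k_i}$. A tuple of permutations $p_i$ of $[n_i]$ with permutation matrices $P_i\in\mathbb{R}^{n_i\times n_i}$, $i=1,\dots,m$, acts by the reordering operator $P_{1:m}\star$: the $(p_1(a_1),\dots,p_m(a_m))$-th entry of $P_{1:m}\star A$ is the $(a_1,\dots,a_m)$-th entry of $A$, where $p_i$ is applied entrywise to the multi-index $a_i$. The same definition is used with exponents $l_i$. A linear map $L$ is invariant if $L(P_{1:m}\star A)=L(A)$, and equivariant if $L(P_{1:m}\star A)=P_{1:m}\star L(A)$, for all $A$ and all tuples $(P_1,\dots,P_m)$ of permutation matrices. A linear map to $\mathbb{R}$ is identified with its coefficient tensor $T$ via $L(A)=\sum_{a}T_{a}A_{a}$, $a=(a_1,\dots,a_m)$, and a linear map between tensor spaces with its coefficient tensor $T$ via $L(A)_{b}=\sum_{a}T_{a,b}A_{a}$, $b=(b_1,\dots,b_m)$; orthogonality is with respect to the standard inner product of coefficient tensors. For $\ell\ge1$, multi-indices $a,b\in[n]^\ell$ satisfy $a\sim b$ iff they have the same equality pattern: $a_i=a_j\Leftrightarrow b_i=b_j$ for all $i,j\in[\ell]$; $[n]^\ell/_\sim$ is the set of equivalence classes. $\mathrm{b}(\ell)$ is the $\ell$-th Bell number, the number of partitions of a set with $\ell$ elements. $[n]^{k}\times[n]^{l}$ is identified with $[n]^{k+l}$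 by concatenation.
   Formalization: The dimension formulas are proved only when k_i ≤ n_i for all i (invariant) or k_i + l_i ≤ n_i for all i (equivariant); otherwise they fail, e.g. m=1, n_1=1, k_1=2 gives dimension 1 but b(2)=2. The orthogonal basis claims hold without this restriction. *)

theory Defs
  imports
    Complex_Main
    "HOL-Library.FuncSet"
    "HOL-Library.Disjoint_Sets"
    "HOL-Library.Function_Algebras"
    "HOL-Combinatorics.Permutations"
begin

text \<open>The pointwise scalar multiplication makes functions into a real vector space, so that
  \<open>subspace\<close>, \<open>span\<close>, \<open>independent\<close> and \<open>dim\<close> apply to spaces of tensors
  and to spaces of linear maps.\<close>

instantiation "fun" :: (type, real_vector) real_vector
begin

definition scaleR_fun_def: "scaleR c f = (\<lambda>x. c *\<^sub>R f x)"

instance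
  by standard (simp_all add: scaleR_fun_def fun_eq_iff scaleR_add_right scaleR_add_left)

end

definition bell :: "nat \<Rightarrow> nat" where
  "bell l = card {P. partition_on {1..l} P}"

text \<open>Elements of \<open>[n]\<^sup>l\<close> are lists (with positions counted from 0), so that the
  concatenation \<open>[n]\<^sup>k \<times> [n]\<^sup>l \<rightarrow> [n]\<^sup>k\<^sup>+\<^sup>l\<close> is \<open>(@)\<close>.\<close>

definition multi_indices :: "nat \<Rightarrow> nat \<Rightarrow> nat list set" where
  "multi_indices n l = {a. set a \<subseteq> {1..n} \<and> length a = l}"

definition same_pattern :: "nat \<Rightarrow> nat \<Rightarrow> (nat list \<times> nat list) set" where
  "same_pattern n l = {(a, b). a \<in> multi_indices n l \<and> b \<in> multi_indices n l \<and>
     (\<forall>i<l. \<forall>j<l. a ! i = a ! j \<longleftrightarrow> b ! i = b ! j)}"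

text \<open>There are \<open>bell l\<close> classes precisely when \<open>l \<le> n\<close>, and fewer otherwise: only the
  partitions with at most \<open>n\<close> blocks occur as equality patterns. Dimension formulas in terms
  of \<open>bell\<close> need this inequality.\<close>

definition pattern_classes :: "nat \<Rightarrow> nat \<Rightarrow> nat list set set" where
  "pattern_classes n l = multi_indices n l // same_pattern n l"

type_synonym index = "nat \<Rightarrow> nat list"

definition tensor_indices :: "nat \<Rightarrow> (nat \<Rightarrow> nat) \<Rightarrow> (nat \<Rightarrow> nat) \<Rightarrow> index set" where
  "tensor_indices m n k = (\<Pi>\<^sub>E i\<in>{1..m}. multi_indices (n i) (k i))"

text \<open>Tensors with index set \<open>I\<close> are the functions that vanish outside \<open>I\<close>.\<close>

definition tensors :: "'i set \<Rightarrow> ('i \<Rightarrow> real) set" where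
  "tensors I = {A. \<forall>a. a \<notin> I \<longrightarrow> A a = 0}"

definition tensor_inner :: "'i set \<Rightarrow> ('i \<Rightarrow> real) \<Rightarrow> ('i \<Rightarrow> real) \<Rightarrow> real" where
  "tensor_inner I S T = (\<Sum>a\<in>I. S a * T a)"

definition permute_index :: "nat \<Rightarrow> (nat \<Rightarrow> nat \<Rightarrow> nat) \<Rightarrow> index \<Rightarrow> index" where
  "permute_index m p a = (\<lambda>i\<in>{1..m}. map (p i) (a i))"

definition perm_tuples :: "nat \<Rightarrow> (nat \<Rightarrow> nat) \<Rightarrow> (nat \<Rightarrow> nat \<Rightarrow> nat) set" where
  "perm_tuples m n = {p. \<forall>i\<in>{1..m}. p i permutes {1..n i}}"

text \<open>The defining property of the reordering operator, that the \<open>p(a)\<close>-th entry of the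
  reordered tensor is the \<open>a\<close>-th entry of \<open>A\<close>, is \<open>reorder_permute_index\<close> below.\<close>

definition reorder ::
  "nat \<Rightarrow> (nat \<Rightarrow> nat) \<Rightarrow> (nat \<Rightarrow> nat) \<Rightarrow> (nat \<Rightarrow> nat \<Rightarrow> nat) \<Rightarrow> (index \<Rightarrow> real) \<Rightarrow> (index \<Rightarrow> real)" where
  "reorder m n k p A =
     (\<lambda>a. if a \<in> tensor_indices m n k then A (permute_index m (\<lambda>i. inv (p i)) a) else 0)"

lemma permute_index_in:
  assumes "p \<in> perm_tuples m n" "a \<in> tensor_indices m n k"
  shows "permute_index m p a \<in> tensor_indices m n k"
proof -
  have "map (p i) (a i) \<in> multi_indices (n i) (k i)" if "i \<in> {1..m}" for i
  proof -
    have "p i permutes {1..n i}" using assms(1) that by (auto simp: perm_tuples_def)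
    moreover have "a i \<in> multi_indices (n i) (k i)"
      using assms(2) that by (auto simp: tensor_indices_def)
    ultimately show ?thesis
      unfolding multi_indices_def using permutes_image by fastforce
  qed
  then show ?thesis by (auto simp: permute_index_def tensor_indices_def)
qed

lemma reorder_permute_index:
  assumes "p \<in> perm_tuples m n" "a \<in> tensor_indices m n k"
  shows "reorder m n k p A (permute_index m p a) = A a"
proof -
  have "permute_index m (\<lambda>i. inv (p i)) (permute_index m p a) = a"
  proof
    fix i
    show "permute_index m (\<lambda>i. inv (p i)) (permute_index m p a) i = a i"
    proof (cases "i \<in> {1..m}")
      case True
      then have "p i permutes {1..n i}" using assms(1) by (auto simp: perm_tuples_def)
      then have "inv (p i) \<circ> p i = id" by (rule permutes_inv_o(2))
      then show ?thesis using True by (simp add: permute_index_def)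
    next
      case False
      have "a i = undefined"
        using assms(2) False unfolding tensor_indices_def by (rule PiE_arb)
      then show ?thesis using False unfolding permute_index_def by (simp only: restrict_apply if_False)
    qed
  qed
  then show ?thesis using permute_index_in[OF assms] by (simp add: reorder_def)
qed

text \<open>Linear maps from a subspace \<open>V\<close> to a subspace \<open>W\<close>; a map on \<open>V\<close> is
  represented by its extension by 0 outside \<open>V\<close>, so that distinct members are distinct maps
  on \<open>V\<close>.\<close>

definition linear_maps :: "'a::real_vector set \<Rightarrow> 'b::real_vector set \<Rightarrow> ('a \<Rightarrow> 'b) set" where
  "linear_maps V W = {L. (\<forall>x\<in>V. L x \<in> W) \<and>
     (\<forall>x\<in>V. \<forall>y\<in>V. L (x + y) = L x + L y) \<and>
     (\<forall>c. \<forall>x\<in>V. L (c *\<^sub>R x) = c *\<^sub>R L x) \<and>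
     (\<forall>x. x \<notin> V \<longrightarrow> L x = 0)}"

definition invariant_maps ::
  "nat \<Rightarrow> (nat \<Rightarrow> nat) \<Rightarrow> (nat \<Rightarrow> nat) \<Rightarrow> ((index \<Rightarrow> real) \<Rightarrow> real) set" where
  "invariant_maps m n k = {L \<in> linear_maps (tensors (tensor_indices m n k)) UNIV.
     \<forall>p\<in>perm_tuples m n. \<forall>A\<in>tensors (tensor_indices m n k). L (reorder m n k p A) = L A}"

definition equivariant_maps ::
  "nat \<Rightarrow> (nat \<Rightarrow> nat) \<Rightarrow> (nat \<Rightarrow> nat) \<Rightarrow> (nat \<Rightarrow> nat)
     \<Rightarrow> ((index \<Rightarrow> real) \<Rightarrow> (index \<Rightarrow> real)) set" where
  "equivariant_maps m n k l =
     {L \<in> linear_maps (tensors (tensor_indices m n k)) (tensors (tensor_indices m n l)).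
      \<forall>p\<in>perm_tuples m n. \<forall>A\<in>tensors (tensor_indices m n k).
        L (reorder m n k p A) = reorder m n l p (L A)}"

text \<open>The identification of coefficient tensors with linear maps. It is bijective, see
  \<open>bij_betw_form_of_tensor\<close> and \<open>bij_betw_map_of_tensor\<close>.\<close>

definition form_of_tensor :: "'i set \<Rightarrow> ('i \<Rightarrow> real) \<Rightarrow> (('i \<Rightarrow> real) \<Rightarrow> real)" where
  "form_of_tensor I T = (\<lambda>A. if A \<in> tensors I then \<Sum>a\<in>I. T a * A a else 0)"

definition map_of_tensor ::
  "'i set \<Rightarrow> 'j set \<Rightarrow> ('i \<times> 'j \<Rightarrow> real) \<Rightarrow> (('i \<Rightarrow> real) \<Rightarrow> ('j \<Rightarrow> real))" where
  "map_of_tensor I J T =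
     (\<lambda>A. if A \<in> tensors I then (\<lambda>b. if b \<in> J then \<Sum>a\<in>I. T (a, b) * A a else 0) else 0)"

text \<open>The tensors \<open>B x\<close>, \<open>x \<in> X\<close>, in \<open>tensors I\<close>, read as linear maps through
  \<open>\<Phi>\<close>, form a basis of \<open>V\<close> without repetitions, and they are pairwise orthogonal.\<close>

definition orthogonal_basis ::
  "'x set \<Rightarrow> ('x \<Rightarrow> ('i \<Rightarrow> real)) \<Rightarrow> 'i set \<Rightarrow> (('i \<Rightarrow> real) \<Rightarrow> 'v::real_vector) \<Rightarrow> 'v set \<Rightarrow> bool" where
  "orthogonal_basis X B I \<Phi> V \<longleftrightarrow>
     (\<forall>x\<in>X. B x \<in> tensors I) \<and>
     inj_on (\<lambda>x. \<Phi> (B x)) X \<and>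
     independent ((\<lambda>x. \<Phi> (B x)) ` X) \<and>
     span ((\<lambda>x. \<Phi> (B x)) ` X) = V \<and>
     (\<forall>x\<in>X. \<forall>y\<in>X. x \<noteq> y \<longrightarrow> tensor_inner I (B x) (B y) = 0)"

definition class_tuples :: "nat \<Rightarrow> (nat \<Rightarrow> nat) \<Rightarrow> (nat \<Rightarrow> nat) \<Rightarrow> (nat \<Rightarrow> nat list set) set" where
  "class_tuples m n k = (\<Pi>\<^sub>E i\<in>{1..m}. pattern_classes (n i) (k i))"

definition inv_basis_tensor ::
  "nat \<Rightarrow> (nat \<Rightarrow> nat) \<Rightarrow> (nat \<Rightarrow> nat) \<Rightarrow> (nat \<Rightarrow> nat list set) \<Rightarrow> (index \<Rightarrow> real)" where
  "inv_basis_tensor m n k cs =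
     (\<lambda>a. if a \<in> tensor_indices m n k \<and> (\<forall>i\<in>{1..m}. a i \<in> cs i) then 1 else 0)"

definition equiv_basis_tensor ::
  "nat \<Rightarrow> (nat \<Rightarrow> nat) \<Rightarrow> (nat \<Rightarrow> nat) \<Rightarrow> (nat \<Rightarrow> nat) \<Rightarrow> (nat \<Rightarrow> nat list set)
     \<Rightarrow> (index \<times> index \<Rightarrow> real)" where
  "equiv_basis_tensor m n k l cs =
     (\<lambda>(a, b). if a \<in> tensor_indices m n k \<and> b \<in> tensor_indices m n l \<and>
        (\<forall>i\<in>{1..m}. a i @ b i \<in> cs i) then 1 else 0)"

lemma equiv_same_pattern: "equiv (multi_indices n l) (same_pattern n l)"
proof (rule equivI)
  show "same_pattern n l \<subseteq> multi_indices n l \<times> multi_indices n l"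
    unfolding same_pattern_def by blast
  show "refl_on (multi_indices n l) (same_pattern n l)"
    unfolding refl_on_def same_pattern_def by blast
  show "sym (same_pattern n l)"
    unfolding sym_def same_pattern_def by blast
  show "trans (same_pattern n l)"
    by (rule transI) (simp add: same_pattern_def)
qed

lemma finite_tensor_indices: "finite (tensor_indices m n k)"
  unfolding tensor_indices_def multi_indices_def
  by (intro finite_PiE ballI finite_lists_length_eq) auto

lemma subspace_tensors: "subspace (tensors I)"
  unfolding subspace_def by (auto simp: tensors_def scaleR_fun_def)

lemma tensor_expand:
  assumes "finite I" "A \<in> tensors I"
  shows "A = (\<Sum>a\<in>I. A a *\<^sub>R (\<lambda>x. if x = a then 1 else 0))"
proof
  fix x
  have *: "(\<Sum>a\<in>J. A a *\<^sub>R (\<lambda>x. if x = a then 1 else 0 :: real)) x =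
      (\<Sum>a\<in>J. A a * (if x = a then 1 else 0))" if "finite J" for J
    using that by (induction J rule: finite_induct) (auto simp: scaleR_fun_def)
  show "A x = (\<Sum>a\<in>I. A a *\<^sub>R (\<lambda>x. if x = a then 1 else 0)) x"
    using assms unfolding *[OF assms(1)] by (cases "x \<in> I") (auto simp: tensors_def if_distrib cong: if_cong)
qed

lemma linear_maps_expand:
  assumes "finite I" "L \<in> linear_maps (tensors I) W" "A \<in> tensors I"
  shows "L A = (\<Sum>a\<in>I. A a *\<^sub>R L (\<lambda>x. if x = a then 1 else 0))"
proof -
  let ?e = "\<lambda>a x. if x = a then 1 else 0 :: real"
  note sub = subspace_tensors[of I]
  have "L (\<Sum>a\<in>J. A a *\<^sub>R ?e a) = (\<Sum>a\<in>J. A a *\<^sub>R L (?e a))" if "finite J" "J \<subseteq> I" for J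
    using that
  proof (induction J rule: finite_induct)
    case empty
    have "L (0 *\<^sub>R A) = 0 *\<^sub>R L A"
      using assms(2,3) unfolding linear_maps_def by blast
    then show ?case by (simp add: zero_fun_def)
  next
    case (insert b J)
    have e: "?e a \<in> tensors I" if "a \<in> I" for a using that by (auto simp: tensors_def)
    have 1: "A b *\<^sub>R ?e b \<in> tensors I"
      using e[of b] insert.prems by (intro subspace_scale[OF sub]) auto
    have 2: "(\<Sum>a\<in>J. A a *\<^sub>R ?e a) \<in> tensors I"
      using e insert.prems by (intro subspace_sum[OF sub] subspace_scale[OF sub]) auto
    have "L (A b *\<^sub>R ?e b + (\<Sum>a\<in>J. A a *\<^sub>R ?e a))
        = L (A b *\<^sub>R ?e b) + L (\<Sum>a\<in>J. A a *\<^sub>R ?e a)"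
      using 1 2 assms(2) unfolding linear_maps_def by blast
    moreover have "L (A b *\<^sub>R ?e b) = A b *\<^sub>R L (?e b)"
      using e[of b] insert.prems assms(2) unfolding linear_maps_def by blast
    ultimately show ?case using insert by (simp add: plus_fun_def)
  qed
  from this[OF assms(1)] show ?thesis
    using tensor_expand[OF assms(1,3)] by (metis (no_types, lifting) order_refl)
qed

lemma bij_betw_form_of_tensor:
  assumes "finite I"
  shows "bij_betw (form_of_tensor I) (tensors I) (linear_maps (tensors I) UNIV)"
proof (rule bij_betw_byWitness)
  let ?e = "\<lambda>a x. if x = a then 1 else 0 :: real"
  let ?g = "\<lambda>L a. if a \<in> I then L (?e a) else 0"
  note sub = subspace_tensors[of I]
  have e: "?e a \<in> tensors I" if "a \<in> I" for a using that by (auto simp: tensors_def)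
  show "\<forall>T\<in>tensors I. ?g (form_of_tensor I T) = T"
  proof (intro ballI ext)
    fix T a assume T: "T \<in> tensors I"
    show "?g (form_of_tensor I T) a = T a"
      using T e[of a] assms
      by (cases "a \<in> I") (auto simp: form_of_tensor_def tensors_def if_distrib cong: if_cong)
  qed
  show "\<forall>L\<in>linear_maps (tensors I) UNIV. form_of_tensor I (?g L) = L"
  proof (intro ballI ext)
    fix L A assume L: "L \<in> linear_maps (tensors I) (UNIV :: real set)"
    show "form_of_tensor I (?g L) A = L A"
    proof (cases "A \<in> tensors I")
      case True
      then show ?thesis
        using linear_maps_expand[OF assms L True] by (simp add: form_of_tensor_def mult.commute)
    next
      case False
      then show ?thesis using L by (auto simp: form_of_tensor_def linear_maps_def)
    qed
  qed
  show "form_of_tensor I ` tensors I \<subseteq> linear_maps (tensors I) UNIV"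
  proof (rule image_subsetI)
    fix T
    have 2: "form_of_tensor I T (A + A') = form_of_tensor I T A + form_of_tensor I T A'"
      if "A \<in> tensors I" "A' \<in> tensors I" for A A'
      using that subspace_add[OF sub that]
      by (simp add: form_of_tensor_def sum.distrib distrib_left)
    have 3: "form_of_tensor I T (c *\<^sub>R A) = c *\<^sub>R form_of_tensor I T A"
      if "A \<in> tensors I" for c A
      using that subspace_scale[OF sub that, of c]
      by (simp add: form_of_tensor_def scaleR_fun_def sum_distrib_left mult.left_commute)
    show "form_of_tensor I T \<in> linear_maps (tensors I) UNIV"
      unfolding linear_maps_def using 2 3 by (simp add: form_of_tensor_def)
  qed
  show "?g ` linear_maps (tensors I) UNIV \<subseteq> tensors I"
    by (auto simp: tensors_def)
qed

lemma bij_betw_map_of_tensor: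
  assumes "finite I"
  shows "bij_betw (map_of_tensor I J) (tensors (I \<times> J)) (linear_maps (tensors I) (tensors J))"
proof (rule bij_betw_byWitness)
  let ?e = "\<lambda>a x. if x = a then 1 else 0 :: real"
  let ?g = "\<lambda>L (a, b). if a \<in> I then L (?e a) b else 0"
  note sub = subspace_tensors[of I]
  have e: "?e a \<in> tensors I" if "a \<in> I" for a using that by (auto simp: tensors_def)
  show "\<forall>T\<in>tensors (I \<times> J). ?g (map_of_tensor I J T) = T"
  proof (intro ballI ext)
    fix T and ab :: "'a \<times> 'b" assume T: "T \<in> tensors (I \<times> J)"
    obtain a b where ab: "ab = (a, b)" by (cases ab)
    show "?g (map_of_tensor I J T) ab = T ab"
      unfolding ab using T e[of a] assms
      by (cases "a \<in> I"; cases "b \<in> J")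
        (auto simp: map_of_tensor_def tensors_def if_distrib cong: if_cong)
  qed
  show "\<forall>L\<in>linear_maps (tensors I) (tensors J). map_of_tensor I J (?g L) = L"
  proof (intro ballI ext)
    fix L A b assume L: "L \<in> linear_maps (tensors I) (tensors J)"
    show "map_of_tensor I J (?g L) A b = L A b"
    proof (cases "A \<in> tensors I")
      case True
      have *: "(\<Sum>a\<in>K. A a *\<^sub>R L (?e a)) b = (\<Sum>a\<in>K. A a * L (?e a) b)" if "finite K" for K
        using that by (induction K rule: finite_induct) (auto simp: scaleR_fun_def)
      have "L A b = (\<Sum>a\<in>I. A a * L (?e a) b)"
        using linear_maps_expand[OF assms L True] *[OF assms] by simp
      moreover have "L A b = 0" if "b \<notin> J"
        using that L True by (auto simp: linear_maps_def tensors_def)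
      ultimately show ?thesis
        using True by (simp add: map_of_tensor_def mult.commute)
    next
      case False
      then show ?thesis using L by (auto simp: map_of_tensor_def linear_maps_def)
    qed
  qed
  show "map_of_tensor I J ` tensors (I \<times> J) \<subseteq> linear_maps (tensors I) (tensors J)"
  proof (rule image_subsetI)
    fix T
    have 1: "map_of_tensor I J T A \<in> tensors J" for A
      by (auto simp: map_of_tensor_def tensors_def)
    have 2: "map_of_tensor I J T (A + A') = map_of_tensor I J T A + map_of_tensor I J T A'"
      if "A \<in> tensors I" "A' \<in> tensors I" for A A'
      using that subspace_add[OF sub that]
      by (simp add: map_of_tensor_def fun_eq_iff sum.distrib distrib_left)
    have 3: "map_of_tensor I J T (c *\<^sub>R A) = c *\<^sub>R map_of_tensor I J T A"
      if "A \<in> tensors I" for c A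
      using that subspace_scale[OF sub that, of c]
      by (simp add: map_of_tensor_def fun_eq_iff scaleR_fun_def sum_distrib_left mult.left_commute)
    have 4: "map_of_tensor I J T A = 0" if "A \<notin> tensors I" for A
      using that by (simp add: map_of_tensor_def)
    show "map_of_tensor I J T \<in> linear_maps (tensors I) (tensors J)"
      unfolding linear_maps_def using 1 2 3 4 by blast
  qed
  show "?g ` linear_maps (tensors I) (tensors J) \<subseteq> tensors (I \<times> J)"
  proof (rule image_subsetI)
    fix L assume L: "L \<in> linear_maps (tensors I) (tensors J)"
    show "?g L \<in> tensors (I \<times> J)"
      using L e by (fastforce simp: tensors_def linear_maps_def)
  qed
qed

end

theory Submission
  imports Defs
begin

text \<open>
  A form is invariant iff its coefficient tensor is constant on the orbits of the simultaneous
  action of the permutations on the index set; for equivariant maps the same holds with the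
  concatenated indices, because \<open>L (P \<star> A) = P \<star> L A\<close> says that \<open>T (p a, b) = T (a, p\<^sup>-\<^sup>1 b)\<close>.
  Two multi-indices lie in the same orbit iff they have the same equality pattern, as an injection
  between subsets of \<open>{1..n}\<close> extends to a permutation. So the \<open>B\<close> are the indicator functions of
  the orbits, which form an orthogonal basis of the space of tensors constant on orbits.
  The equality patterns of \<open>l \<le> n\<close> entries correspond to the partitions of the \<open>l\<close> positions.
\<close>

section \<open>Indicator functions of fibres as an orthogonal basis\<close>

lemma sum_scaleR_fun_apply: "(\<Sum>x\<in>X. c x *\<^sub>R f x) z = (\<Sum>x\<in>X. c x *\<^sub>R f x z)"
  by (induction X rule: infinite_finite_induct) (simp_all add: scaleR_fun_def)

text \<open>The fibres of \<open>c\<close> over \<open>X\<close> are nonempty and disjoint, and a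
  tensor constant on them is the combination of their indicators \<open>B x\<close> with its values
  as coefficients. Leaving \<open>c\<close> abstract covers both cases: it becomes the orbit label
  of a single index or of a pair of indices.\<close>

lemma orthogonal_basis_indicators:
  fixes c :: "'z \<Rightarrow> 'x" and \<Phi> :: "('z \<Rightarrow> real) \<Rightarrow> 'v::real_vector"
  assumes fin: "finite Z" and X: "X = c ` Z"
    and B: "\<And>x z. x \<in> X \<Longrightarrow> B x z = (if z \<in> Z \<and> c z = x then 1 else 0)"
    and \<Phi>: "linear \<Phi>" "inj_on \<Phi> (tensors Z)"
    and V: "V = \<Phi> ` {T \<in> tensors Z. \<forall>z\<in>Z. \<forall>w\<in>Z. c z = c w \<longrightarrow> T z = T w}"
  shows "orthogonal_basis X B Z \<Phi> V" "dim V = card X"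
proof -
  let ?U = "{T \<in> tensors Z. \<forall>z\<in>Z. \<forall>w\<in>Z. c z = c w \<longrightarrow> T z = T w}"
  have finX: "finite X" using fin X by simp
  have B_tensor: "B x \<in> tensors Z" if "x \<in> X" for x
    using that by (simp add: B tensors_def)
  have inj_B: "inj_on B X"
  proof (rule inj_onI)
    fix x y assume xy: "x \<in> X" "y \<in> X" "B x = B y"
    then obtain z where z: "z \<in> Z" "c z = x" using X by blast
    have "B x z = B y z" using xy by simp
    then show "x = y" using xy(1,2) z by (simp add: B split: if_splits)
  qed
  \<comment> \<open>At each point of \<open>Z\<close> exactly one indicator is nonzero, so
    evaluation there isolates one coefficient. Both independence and spanning rest on this.\<close>
  have comb: "(\<Sum>x\<in>X. u x *\<^sub>R B x) z = (if z \<in> Z then u (c z) else 0)" for u z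
  proof -
    have "(\<Sum>x\<in>X. u x *\<^sub>R B x) z = (\<Sum>x\<in>X. if z \<in> Z \<and> c z = x then u x else 0)"
      unfolding sum_scaleR_fun_apply by (rule sum.cong) (auto simp: B)
    also have "\<dots> = (if z \<in> Z then u (c z) else 0)"
      using finX X by (cases "z \<in> Z") auto
    finally show ?thesis .
  qed
  have indep: "independent (B ` X)"
  proof (rule independent_if_scalars_zero)
    show "finite (B ` X)" using finX by simp
  next
    fix f T assume f: "(\<Sum>T\<in>B ` X. f T *\<^sub>R T) = 0" and "T \<in> B ` X"
    then obtain z where z: "z \<in> Z" "T = B (c z)" using X by blast
    have "(\<Sum>x\<in>X. f (B x) *\<^sub>R B x) = 0"
      using f by (simp add: sum.reindex[OF inj_B])
    then have "(\<Sum>x\<in>X. f (B x) *\<^sub>R B x) z = 0" by simp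
    then show "f T = 0" using z by (simp add: comb)
  qed
  have span: "span (B ` X) = ?U"
  proof
    have "subspace ?U"
    proof (rule subspaceI)
      show "0 \<in> ?U" by (simp add: tensors_def)
    next
      fix S T assume S: "S \<in> ?U" and T: "T \<in> ?U"
      have "(S + T) z = (S + T) w" if "z \<in> Z" "w \<in> Z" "c z = c w" for z w
      proof -
        have "S z = S w" "T z = T w" using S T that by blast+
        then show ?thesis by simp
      qed
      then show "S + T \<in> ?U" using S T subspace_add[OF subspace_tensors] by blast
    next
      fix u T assume T: "T \<in> ?U"
      have "(u *\<^sub>R T) z = (u *\<^sub>R T) w" if "z \<in> Z" "w \<in> Z" "c z = c w" for z w
      proof -
        have "T z = T w" using T that by blast
        then show ?thesis by (simp add: scaleR_fun_def)
      qed
      then show "u *\<^sub>R T \<in> ?U" using T subspace_scale[OF subspace_tensors] by blast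
    qed
    moreover have "B ` X \<subseteq> ?U" using B_tensor by (auto simp: B)
    ultimately show "span (B ` X) \<subseteq> ?U" by (rule span_minimal[rotated])
    show "?U \<subseteq> span (B ` X)"
    proof
      fix T assume T: "T \<in> ?U"
      \<comment> \<open>\<open>inv_into Z c\<close> picks a representative of each fibre; the value
        of \<open>T\<close> there serves as the coefficient.\<close>
      have rep: "inv_into Z c (c z) \<in> Z" "c (inv_into Z c (c z)) = c z" if "z \<in> Z" for z
        using that by (auto intro: inv_into_into f_inv_into_f)
      have "T = (\<Sum>x\<in>X. T (inv_into Z c x) *\<^sub>R B x)"
      proof
        fix z
        have "T z = T (inv_into Z c (c z))" if "z \<in> Z"
          using T that rep(1)[OF that] rep(2)[OF that, symmetric] by blast
        moreover have "T z = 0" if "z \<notin> Z"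
          using T that by (simp add: tensors_def)
        ultimately show "T z = (\<Sum>x\<in>X. T (inv_into Z c x) *\<^sub>R B x) z"
          unfolding comb by simp
      qed
      also have "\<dots> \<in> span (B ` X)"
        by (intro span_sum span_scale span_base imageI)
      finally show "T \<in> span (B ` X)" .
    qed
  qed
  \<comment> \<open>\<Phi> is assumed injective on \<open>tensors Z\<close> only; this contains the
    span of the indicators, which suffices to transport independence.\<close>
  have inj_\<Phi>: "inj_on \<Phi> (span (B ` X))"
    using \<Phi>(2) unfolding span by (rule inj_on_subset) auto
  have img: "(\<lambda>x. \<Phi> (B x)) ` X = \<Phi> ` B ` X" by (simp add: image_image)
  have inj: "inj_on (\<lambda>x. \<Phi> (B x)) X"
    using comp_inj_on[OF inj_B inj_on_subset[OF inj_\<Phi> span_superset]] by (simp add: comp_def)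
  have indep': "independent ((\<lambda>x. \<Phi> (B x)) ` X)"
    unfolding img using \<Phi>(1) indep inj_\<Phi> by (rule linear_independent_injective_image)
  have span': "span ((\<lambda>x. \<Phi> (B x)) ` X) = V"
    unfolding img linear_span_image[OF \<Phi>(1)] span V ..
  \<comment> \<open>Distinct fibres are disjoint, so every summand has a zero factor.\<close>
  have "tensor_inner Z (B x) (B y) = 0" if "x \<in> X" "y \<in> X" "x \<noteq> y" for x y
    unfolding tensor_inner_def using that by (intro sum.neutral) (auto simp: B)
  then show "orthogonal_basis X B Z \<Phi> V"
    unfolding orthogonal_basis_def using B_tensor inj indep' span' by blast
  show "dim V = card X"
    unfolding span'[symmetric] dim_span_eq_card_independent[OF indep'] using inj by (rule card_image)
qed

lemma subspace_if_orthogonal_basis: "orthogonal_basis X B I \<Phi> V \<Longrightarrow> subspace V"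
  unfolding orthogonal_basis_def using subspace_span by metis

section \<open>Equality patterns and permutations\<close>

lemma same_pattern_if_map:
  assumes "p permutes {1..n}" "a \<in> multi_indices n l"
  shows "(a, map p a) \<in> same_pattern n l"
  using assms permutes_in_image[OF assms(1)] permutes_inj[OF assms(1)]
  by (auto simp: same_pattern_def multi_indices_def inj_eq)

text \<open>Sending \<open>a ! i\<close> to \<open>b ! i\<close> is well defined and injective
  because the patterns agree. It is completed to a permutation by any bijection between the values
  missed by \<open>a\<close> and those missed by \<open>b\<close>.\<close>

lemma map_if_same_pattern:
  assumes "(a, b) \<in> same_pattern n l"
  obtains p where "p permutes {1..n}" "map p a = b"
proof -
  from assms have a: "set a \<subseteq> {1..n}" "length a = l" and b: "set b \<subseteq> {1..n}" "length b = l"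
    and ab: "\<And>i j. i < l \<Longrightarrow> j < l \<Longrightarrow> a ! i = a ! j \<longleftrightarrow> b ! i = b ! j"
    by (auto simp: same_pattern_def multi_indices_def)
  \<comment> \<open>The choice picks some position of \<open>x\<close> in \<open>a\<close>; by
    \<open>ab\<close>, the entry of \<open>b\<close> is the same at all such positions.\<close>
  define g where "g x = b ! (SOME i. i < l \<and> a ! i = x)" for x
  have g: "g (a ! i) = b ! i" if "i < l" for i
  proof -
    have "(SOME j. j < l \<and> a ! j = a ! i) < l \<and> a ! (SOME j. j < l \<and> a ! j = a ! i) = a ! i"
      using that by (intro someI[of "\<lambda>j. j < l \<and> a ! j = a ! i"]) auto
    then show ?thesis unfolding g_def using ab that by blast
  qed
  have set_a: "set a = (!) a ` {..<l}" and set_b: "set b = (!) b ` {..<l}"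
    using a b by (auto simp: set_conv_nth)
  have bij_g: "bij_betw g (set a) (set b)"
    unfolding bij_betw_def set_a set_b by (auto simp: inj_on_def g ab image_image)
  have "card ({1..n} - set a) = card ({1..n} - set b)"
    using a b bij_betw_same_card[OF bij_g] by (simp add: card_Diff_subset)
  then obtain h where h: "bij_betw h ({1..n} - set a) ({1..n} - set b)"
    by (meson finite_Diff finite_atLeastAtMost finite_same_card_bij)
  \<comment> \<open>The last branch fixes everything outside \<open>{1..n}\<close>, as
    \<open>permutes\<close> demands.\<close>
  define p where "p x = (if x \<in> set a then g x else if x \<in> {1..n} then h x else x)" for x
  have "bij_betw p (set a \<union> ({1..n} - set a)) (set b \<union> ({1..n} - set b))"
  proof (rule bij_betw_combine)
    show "bij_betw p (set a) (set b)"
      using bij_g by (rule bij_betw_cong[THEN iffD1, rotated]) (simp add: p_def)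
    show "bij_betw p ({1..n} - set a) ({1..n} - set b)"
      using h by (rule bij_betw_cong[THEN iffD1, rotated]) (simp add: p_def)
  qed auto
  then have "bij_betw p {1..n} {1..n}"
    using a b by (simp add: Un_absorb1)
  then have "p permutes {1..n}"
    using a(1) by (intro bij_imp_permutes) (auto simp: p_def)
  moreover have "map p a = b"
    using a b by (auto intro!: nth_equalityI simp: p_def g)
  ultimately show thesis ..
qed

section \<open>Counting equality patterns by Bell numbers\<close>

lemma card_quotient_kernel_on:
  "card (A // {(a, b). a \<in> A \<and> b \<in> A \<and> F a = F b}) = card (F ` A)"
proof -
  have "A // {(a, b). a \<in> A \<and> b \<in> A \<and> F a = F b} = (\<lambda>a. {b \<in> A. F b = F a}) ` A"
    unfolding quotient_def by (auto simp: Image_def eq_commute)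
  also have "\<dots> = (\<lambda>y. {b \<in> A. F b = y}) ` F ` A"
    by (simp add: image_image)
  finally have "A // {(a, b). a \<in> A \<and> b \<in> A \<and> F a = F b} = (\<lambda>y. {b \<in> A. F b = y}) ` F ` A" .
  \<comment> \<open>A fibre over a value in the image is nonempty and hence determines that
    value.\<close>
  moreover have "inj_on (\<lambda>y. {b \<in> A. F b = y}) (F ` A)"
    by (rule inj_onI) blast
  ultimately show ?thesis by (simp add: card_image)
qed

text \<open>\<open>F\<close> groups the positions of a multi-index into blocks of equal entries.
  Having the same pattern is the kernel of \<open>F\<close>, so the classes are counted by the image
  of \<open>F\<close>; the bound \<open>l \<le> n\<close> makes this image contain every
  partition.\<close>

lemma card_pattern_classes:
  assumes "l \<le> n"
  shows "card (pattern_classes n l) = bell l"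
proof -
  \<comment> \<open>Positions run through \<open>{1..l}\<close> here, to match \<open>bell\<close>,
    while lists count from 0; hence the shift \<open>i - 1\<close>.\<close>
  define E where "E a = {(i, j). i \<in> {1..l} \<and> j \<in> {1..l} \<and> a ! (i - 1) = a ! (j - 1)}"
    for a :: "nat list"
  define F where "F a = {1..l} // E a" for a
  have E: "equiv {1..l} (E a)" for a
    by (rule equivI) (auto simp: E_def refl_on_def sym_def trans_def)
  have F_eq_iff: "F a = F b \<longleftrightarrow> E a = E b" for a b
  proof
    assume F: "F a = F b"
    \<comment> \<open>The partition determines the relation: two positions are related iff they
      share a block.\<close>
    have "E a = {(x, y). \<exists>p\<in>F a. x \<in> p \<and> y \<in> p}" for a
      unfolding F_def quotient_def by (auto simp: E_def)
    from this[of a] this[of b] show "E a = E b" unfolding F by simp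
  qed (simp add: F_def)
  have E_eq_iff: "E a = E b \<longleftrightarrow> (\<forall>i<l. \<forall>j<l. a ! i = a ! j \<longleftrightarrow> b ! i = b ! j)" for a b
  proof
    assume "E a = E b"
    then have mem: "(Suc i, Suc j) \<in> E a \<longleftrightarrow> (Suc i, Suc j) \<in> E b" for i j by (rule arg_cong)
    have "a ! i = a ! j \<longleftrightarrow> b ! i = b ! j" if "i < l" "j < l" for i j
      using mem[of i j] that by (simp add: E_def Suc_le_eq)
    then show "\<forall>i<l. \<forall>j<l. a ! i = a ! j \<longleftrightarrow> b ! i = b ! j" by blast
  next
    assume *: "\<forall>i<l. \<forall>j<l. a ! i = a ! j \<longleftrightarrow> b ! i = b ! j"
    have "a ! (i - 1) = a ! (j - 1) \<longleftrightarrow> b ! (i - 1) = b ! (j - 1)"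
      if "i \<in> {1..l}" "j \<in> {1..l}" for i j
    proof -
      have "i - 1 < l" "j - 1 < l" using that by auto
      then show ?thesis using * by blast
    qed
    then show "E a = E b" unfolding E_def by blast
  qed
  have "same_pattern n l = {(a, b). a \<in> multi_indices n l \<and> b \<in> multi_indices n l \<and> F a = F b}"
    by (simp add: same_pattern_def F_eq_iff E_eq_iff)
  then have "card (pattern_classes n l) = card (F ` multi_indices n l)"
    unfolding pattern_classes_def by (simp only: card_quotient_kernel_on)
  also have "F ` multi_indices n l = {P. partition_on {1..l} P}"
  proof
    show "F ` multi_indices n l \<subseteq> {P. partition_on {1..l} P}"
      using partition_on_quotient[OF E] by (auto simp: F_def)
    show "{P. partition_on {1..l} P} \<subseteq> F ` multi_indices n l"
    proof
      fix P assume "P \<in> {P. partition_on {1..l} P}"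
      then obtain r where r: "equiv {1..l} r" and P: "P = {1..l} // r"
        unfolding mem_Collect_eq partition_on_alt by blast
      \<comment> \<open>Label every position by the least element of its block; this fits into \<open>{1..n}\<close>
        because \<open>l \<le> n\<close>.\<close>
      define a where "a = map (\<lambda>i. Min (r `` {Suc i})) [0..<l]"
      have sub: "r `` {i} \<subseteq> {1..l}" for i
        using equiv_type[OF r] by auto
      have Min_in: "Min (r `` {i}) \<in> r `` {i}" if "i \<in> {1..l}" for i
        using equiv_class_self[OF r that] finite_subset[OF sub] by (intro Min_in) auto
      have "Min (r `` {i}) \<in> {1..n}" if "i \<in> {1..l}" for i
        using Min_in[OF that] sub[of i] assms by (meson atLeastAtMost_iff order_trans subsetD)
      then have a: "a \<in> multi_indices n l"
        by (auto simp: a_def multi_indices_def)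
      have nth: "a ! (i - 1) = Min (r `` {i})" if "i \<in> {1..l}" for i
        using that by (cases i) (simp_all add: a_def)
      \<comment> \<open>Blocks with the same minimum have a common element and therefore
        coincide.\<close>
      have "Min (r `` {i}) = Min (r `` {j}) \<longleftrightarrow> (i, j) \<in> r" if "i \<in> {1..l}" "j \<in> {1..l}" for i j
      proof
        assume eq: "Min (r `` {i}) = Min (r `` {j})"
        have "(i, Min (r `` {i})) \<in> r" "(j, Min (r `` {i})) \<in> r"
          using Min_in[OF that(1)] Min_in[OF that(2)] unfolding eq by auto
        then show "(i, j) \<in> r"
          using r by (meson equivE symD transD)
      next
        assume "(i, j) \<in> r"
        then show "Min (r `` {i}) = Min (r `` {j})" using equiv_class_eq[OF r] by metis
      qed
      then have "a ! (i - 1) = a ! (j - 1) \<longleftrightarrow> (i, j) \<in> r" if "i \<in> {1..l}" "j \<in> {1..l}" for i j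
        using nth that by simp
      then have "E a = r"
        unfolding E_def using equiv_type[OF r] by blast
      then have "F a = P" by (simp add: F_def P)
      then show "P \<in> F ` multi_indices n l" using a by blast
    qed
  qed
  finally show ?thesis by (simp add: bell_def)
qed

lemma card_class_tuples:
  assumes "\<forall>i\<in>{1..m}. k i \<le> n i"
  shows "card (class_tuples m n k) = (\<Prod>i=1..m. bell (k i))"
  unfolding class_tuples_def using assms by (simp add: card_PiE card_pattern_classes)

section \<open>Orbits of permutation tuples on tensor indices\<close>

definition index_class ::
  "nat \<Rightarrow> (nat \<Rightarrow> nat) \<Rightarrow> (nat \<Rightarrow> nat) \<Rightarrow> index \<Rightarrow> (nat \<Rightarrow> nat list set)" where
  "index_class m n k a = (\<lambda>i\<in>{1..m}. same_pattern (n i) (k i) `` {a i})"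

text \<open>Choosing a representative in each component shows that every class tuple occurs as a
  label, as required of \<open>c\<close> in \<open>orthogonal_basis_indicators\<close>.\<close>

lemma index_class_image: "index_class m n k ` tensor_indices m n k = class_tuples m n k"
proof
  show "index_class m n k ` tensor_indices m n k \<subseteq> class_tuples m n k"
    unfolding index_class_def tensor_indices_def class_tuples_def pattern_classes_def
    by (intro image_subsetI restrict_PiE_iff[THEN iffD2] ballI quotientI) (rule PiE_mem)
  show "class_tuples m n k \<subseteq> index_class m n k ` tensor_indices m n k"
  proof
    fix cs assume cs: "cs \<in> class_tuples m n k"
    have "\<exists>a. a \<in> multi_indices (n i) (k i) \<and> cs i = same_pattern (n i) (k i) `` {a}"
      if "i \<in> {1..m}" for i
      using cs that
      by (fastforce simp: class_tuples_def pattern_classes_def quotient_def dest!: PiE_mem)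
    then obtain a where a: "\<And>i. i \<in> {1..m} \<Longrightarrow> a i \<in> multi_indices (n i) (k i)"
      "\<And>i. i \<in> {1..m} \<Longrightarrow> cs i = same_pattern (n i) (k i) `` {a i}"
      by metis
    \<comment> \<open>Outside \<open>{1..m}\<close> both sides are \<open>undefined\<close>, the
      value of an extensional function off its domain.\<close>
    have "cs = index_class m n k (restrict a {1..m})"
    proof
      fix i
      show "cs i = index_class m n k (restrict a {1..m}) i"
        using a(2)[of i] PiE_arb[OF cs[unfolded class_tuples_def], of i]
        by (cases "i \<in> {1..m}") (simp_all only: index_class_def restrict_apply if_True if_False not_False_eq_True)
    qed
    moreover have "restrict a {1..m} \<in> tensor_indices m n k"
      unfolding tensor_indices_def using a(1) by auto
    ultimately show "cs \<in> index_class m n k ` tensor_indices m n k" by blast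
  qed
qed

lemma index_class_eq_iff:
  assumes a: "a \<in> tensor_indices m n k" and b: "b \<in> tensor_indices m n k"
  shows "index_class m n k a = index_class m n k b \<longleftrightarrow> (\<forall>i\<in>{1..m}. (a i, b i) \<in> same_pattern (n i) (k i))"
proof -
  have "index_class m n k a = index_class m n k b \<longleftrightarrow>
      (\<forall>i\<in>{1..m}. same_pattern (n i) (k i) `` {a i} = same_pattern (n i) (k i) `` {b i})"
    unfolding index_class_def by (auto simp: fun_eq_iff restrict_def)
  also have "\<dots> \<longleftrightarrow> (\<forall>i\<in>{1..m}. (a i, b i) \<in> same_pattern (n i) (k i))"
    using a b unfolding tensor_indices_def
    by (intro ball_cong refl eq_equiv_class_iff[OF equiv_same_pattern]) (auto dest: PiE_mem)
  finally show ?thesis .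
qed

text \<open>Links the labels to the membership conditions that define the basis tensors, by writing
  \<open>cs\<close> as the label of a representative \<open>b\<close>.\<close>

lemma index_class_eq_iff_mem:
  assumes a: "a \<in> tensor_indices m n k" and cs: "cs \<in> class_tuples m n k"
  shows "index_class m n k a = cs \<longleftrightarrow> (\<forall>i\<in>{1..m}. a i \<in> cs i)"
proof -
  obtain b where b: "b \<in> tensor_indices m n k" "cs = index_class m n k b"
    using cs index_class_image by blast
  have "index_class m n k a = cs \<longleftrightarrow> (\<forall>i\<in>{1..m}. (b i, a i) \<in> same_pattern (n i) (k i))"
    unfolding b(2) using index_class_eq_iff[OF b(1) a] by auto
  then show ?thesis by (simp add: b(2) index_class_def)
qed

text \<open>The labels separate exactly the orbits: the components of a permutation tuple can be
  chosen independently, so one permutation is taken per component.\<close>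

lemma index_class_eq_iff_permute:
  assumes a: "a \<in> tensor_indices m n k" and b: "b \<in> tensor_indices m n k"
  shows "index_class m n k a = index_class m n k b \<longleftrightarrow> (\<exists>p\<in>perm_tuples m n. b = permute_index m p a)"
  unfolding index_class_eq_iff[OF a b]
proof
  assume "\<forall>i\<in>{1..m}. (a i, b i) \<in> same_pattern (n i) (k i)"
  then have "\<forall>i\<in>{1..m}. \<exists>q. q permutes {1..n i} \<and> map q (a i) = b i"
    by (meson map_if_same_pattern)
  then obtain p where p: "\<And>i. i \<in> {1..m} \<Longrightarrow> p i permutes {1..n i}"
    "\<And>i. i \<in> {1..m} \<Longrightarrow> map (p i) (a i) = b i"
    unfolding bchoice_iff by blast
  have "p \<in> perm_tuples m n" using p(1) by (simp add: perm_tuples_def)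
  moreover have "b = permute_index m p a"
  proof
    fix i show "b i = permute_index m p a i"
      using p(2)[of i] PiE_arb[OF b[unfolded tensor_indices_def], of i]
      by (cases "i \<in> {1..m}") (simp_all only: permute_index_def restrict_apply if_True if_False not_False_eq_True)
  qed
  ultimately show "\<exists>p\<in>perm_tuples m n. b = permute_index m p a"
    by blast
next
  assume "\<exists>p\<in>perm_tuples m n. b = permute_index m p a"
  then obtain p where p: "p \<in> perm_tuples m n" "b = permute_index m p a" by blast
  show "\<forall>i\<in>{1..m}. (a i, b i) \<in> same_pattern (n i) (k i)"
  proof
    fix i assume i: "i \<in> {1..m}"
    have "(a i, map (p i) (a i)) \<in> same_pattern (n i) (k i)"
    proof (rule same_pattern_if_map)
      show "p i permutes {1..n i}" using p(1) i by (auto simp: perm_tuples_def)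
      show "a i \<in> multi_indices (n i) (k i)" using a i unfolding tensor_indices_def by (rule PiE_mem)
    qed
    then show "(a i, b i) \<in> same_pattern (n i) (k i)"
      using i by (simp add: p(2) permute_index_def)
  qed
qed

section \<open>Invariance and equivariance in terms of coefficient tensors\<close>

lemma permute_index_inverse:
  assumes "p \<in> perm_tuples m n" "a \<in> tensor_indices m n k"
  shows "permute_index m (\<lambda>i. inv (p i)) (permute_index m p a) = a"
    and "permute_index m p (permute_index m (\<lambda>i. inv (p i)) a) = a"
proof -
  have p: "map (inv (p i)) (map (p i) xs) = xs" "map (p i) (map (inv (p i)) xs) = xs"
    if "i \<in> {1..m}" for i xs
  proof -
    have "p i permutes {1..n i}" using assms(1) that by (auto simp: perm_tuples_def)
    then show "map (inv (p i)) (map (p i) xs) = xs" "map (p i) (map (inv (p i)) xs) = xs"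
      by (simp_all add: permutes_inverses comp_def)
  qed
  have a: "a i = undefined" if "i \<notin> {1..m}" for i
    using assms(2) that unfolding tensor_indices_def by (rule PiE_arb)
  show "permute_index m (\<lambda>i. inv (p i)) (permute_index m p a) = a"
    "permute_index m p (permute_index m (\<lambda>i. inv (p i)) a) = a"
    using a by (auto simp: permute_index_def restrict_def p simp del: map_map)
qed

lemma perm_tuples_inv: "p \<in> perm_tuples m n \<Longrightarrow> (\<lambda>i. inv (p i)) \<in> perm_tuples m n"
  by (simp add: perm_tuples_def permutes_inv)

lemma bij_betw_permute_index:
  assumes p: "p \<in> perm_tuples m n"
  shows "bij_betw (permute_index m p) (tensor_indices m n k) (tensor_indices m n k)"
  by (rule bij_betw_byWitness[where f' = "permute_index m (\<lambda>i. inv (p i))"])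
    (auto simp: permute_index_inverse[OF p] intro: permute_index_in[OF p] permute_index_in[OF perm_tuples_inv[OF p]])

lemma reorder_in_tensors: "reorder m n k p A \<in> tensors (tensor_indices m n k)"
  by (simp add: reorder_def tensors_def)

text \<open>Substituting \<open>permute_index m p a\<close> for \<open>a\<close> moves the
  permutation from the argument to the coefficients.\<close>

lemma sum_reorder:
  assumes p: "p \<in> perm_tuples m n"
  shows "(\<Sum>a\<in>tensor_indices m n k. c a * reorder m n k p A a) =
    (\<Sum>a\<in>tensor_indices m n k. c (permute_index m p a) * A a)"
proof -
  have "(\<Sum>a\<in>tensor_indices m n k. c a * reorder m n k p A a) =
    (\<Sum>a\<in>tensor_indices m n k. c (permute_index m p a) * reorder m n k p A (permute_index m p a))"
    by (rule sum.reindex_bij_betw[OF bij_betw_permute_index[OF p], symmetric])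
  then show ?thesis by (simp add: reorder_permute_index[OF p])
qed

text \<open>Unit tensors pick out single coefficients, so an identity for all arguments can be read
  off entrywise.\<close>

lemma sum_tensors_eq_iff:
  assumes "finite I"
  shows "(\<forall>A\<in>tensors I. (\<Sum>a\<in>I. f a * A a) = (\<Sum>a\<in>I. g a * A a)) \<longleftrightarrow> (\<forall>a\<in>I. f a = g a)"
proof
  assume *: "\<forall>A\<in>tensors I. (\<Sum>a\<in>I. f a * A a) = (\<Sum>a\<in>I. g a * A a)"
  show "\<forall>a\<in>I. f a = g a"
  proof
    fix a assume a: "a \<in> I"
    have "(\<lambda>x. if x = a then 1 else 0) \<in> tensors I" using a by (auto simp: tensors_def)
    from *[rule_format, OF this] show "f a = g a"
      using a assms by (simp add: if_distrib cong: if_cong)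
  qed
qed simp

lemma form_of_tensor_invariant_iff:
  assumes T: "T \<in> tensors (tensor_indices m n k)"
  shows "form_of_tensor (tensor_indices m n k) T \<in> invariant_maps m n k \<longleftrightarrow>
    (\<forall>p\<in>perm_tuples m n. \<forall>a\<in>tensor_indices m n k. T (permute_index m p a) = T a)"
proof -
  let ?I = "tensor_indices m n k"
  have "form_of_tensor ?I T \<in> linear_maps (tensors ?I) UNIV"
    using bij_betwE[OF bij_betw_form_of_tensor[OF finite_tensor_indices]] T by blast
  then have "form_of_tensor ?I T \<in> invariant_maps m n k \<longleftrightarrow>
      (\<forall>p\<in>perm_tuples m n. \<forall>A\<in>tensors ?I.
        (\<Sum>a\<in>?I. T (permute_index m p a) * A a) = (\<Sum>a\<in>?I. T a * A a))"
    by (simp add: invariant_maps_def form_of_tensor_def reorder_in_tensors sum_reorder)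
  then show ?thesis by (simp add: sum_tensors_eq_iff finite_tensor_indices)
qed

text \<open>Comparing output entries at \<open>permute_index m p b\<close> rather than at
  \<open>b\<close> undoes the reordering of the output and leaves the same \<open>p\<close> on both
  arguments of \<open>T\<close>.\<close>

lemma map_of_tensor_equivariant_iff:
  assumes T: "T \<in> tensors (tensor_indices m n k \<times> tensor_indices m n l)"
  shows "map_of_tensor (tensor_indices m n k) (tensor_indices m n l) T \<in> equivariant_maps m n k l \<longleftrightarrow>
    (\<forall>p\<in>perm_tuples m n. \<forall>a\<in>tensor_indices m n k. \<forall>b\<in>tensor_indices m n l.
      T (permute_index m p a, permute_index m p b) = T (a, b))"
proof -
  let ?I = "tensor_indices m n k" and ?J = "tensor_indices m n l"
  let ?L = "map_of_tensor ?I ?J T"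
  have lin: "?L \<in> linear_maps (tensors ?I) (tensors ?J)"
    using bij_betwE[OF bij_betw_map_of_tensor[OF finite_tensor_indices]] T by blast
  have "(\<forall>A\<in>tensors ?I. ?L (reorder m n k p A) = reorder m n l p (?L A)) \<longleftrightarrow>
      (\<forall>a\<in>?I. \<forall>b\<in>?J. T (permute_index m p a, permute_index m p b) = T (a, b))"
    if p: "p \<in> perm_tuples m n" for p
  proof -
    note bij = bij_betw_permute_index[OF p, of l]
    have "?L (reorder m n k p A) = reorder m n l p (?L A) \<longleftrightarrow>
        (\<forall>b\<in>?J. (\<Sum>a\<in>?I. T (permute_index m p a, permute_index m p b) * A a) = (\<Sum>a\<in>?I. T (a, b) * A a))"
      if A: "A \<in> tensors ?I" for A
    proof -
      \<comment> \<open>Outside \<open>?J\<close> both sides vanish.\<close>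
      have "?L (reorder m n k p A) = reorder m n l p (?L A) \<longleftrightarrow>
          (\<forall>b\<in>?J. ?L (reorder m n k p A) b = reorder m n l p (?L A) b)"
        by (auto simp: fun_eq_iff map_of_tensor_def reorder_def)
      \<comment> \<open>\<open>?J\<close> is replaced by its image under
        \<open>permute_index m p\<close>, so that \<open>reorder_permute_index\<close> evaluates the
        right-hand side.\<close>
      also have "\<dots> \<longleftrightarrow> (\<forall>b\<in>permute_index m p ` ?J. ?L (reorder m n k p A) b = reorder m n l p (?L A) b)"
        using bij by (simp add: bij_betw_def)
      also have "\<dots> \<longleftrightarrow> (\<forall>b\<in>?J. (\<Sum>a\<in>?I. T (permute_index m p a, permute_index m p b) * A a) =
          (\<Sum>a\<in>?I. T (a, b) * A a))"
        using A by (simp add: reorder_permute_index[OF p] map_of_tensor_def reorder_in_tensors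
            permute_index_in[OF p] sum_reorder[OF p])
      finally show ?thesis .
    qed
    \<comment> \<open>Exchanging the quantifiers over \<open>A\<close> and \<open>b\<close> allows
      coefficients to be compared for each fixed \<open>b\<close>.\<close>
    then have "(\<forall>A\<in>tensors ?I. ?L (reorder m n k p A) = reorder m n l p (?L A)) \<longleftrightarrow>
        (\<forall>b\<in>?J. \<forall>A\<in>tensors ?I.
          (\<Sum>a\<in>?I. T (permute_index m p a, permute_index m p b) * A a) = (\<Sum>a\<in>?I. T (a, b) * A a))"
      by blast
    then show ?thesis by (auto simp: sum_tensors_eq_iff finite_tensor_indices)
  qed
  with lin show ?thesis by (simp add: equivariant_maps_def)
qed

text \<open>This is linearity in the coefficient tensor, not in the argument \<open>A\<close>; it
  carries the basis of tensors over to the maps.\<close>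

lemma linear_form_of_tensor: "linear (form_of_tensor I)"
  by (rule linearI)
    (auto simp: form_of_tensor_def fun_eq_iff scaleR_fun_def distrib_right sum.distrib
      sum_distrib_left mult.assoc)

lemma linear_map_of_tensor: "linear (map_of_tensor I J)"
  by (rule linearI)
    (auto simp: map_of_tensor_def fun_eq_iff scaleR_fun_def distrib_right sum.distrib
      sum_distrib_left mult.assoc)

lemma image_eq_if_bij_betw_iff:
  assumes "bij_betw f A B" "V \<subseteq> B" "\<And>x. x \<in> A \<Longrightarrow> f x \<in> V \<longleftrightarrow> P x"
  shows "V = f ` {x \<in> A. P x}"
  using assms unfolding bij_betw_def by blast

section \<open>The invariant case\<close>

lemma invariant_maps_basis:
  shows "orthogonal_basis (class_tuples m n k) (inv_basis_tensor m n k) (tensor_indices m n k)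
      (form_of_tensor (tensor_indices m n k)) (invariant_maps m n k)" (is ?basis)
    and "dim (invariant_maps m n k) = card (class_tuples m n k)" (is ?dim)
proof -
  let ?I = "tensor_indices m n k"
  note bij = bij_betw_form_of_tensor[OF finite_tensor_indices, of m n k]
  have B: "inv_basis_tensor m n k cs a = (if a \<in> ?I \<and> index_class m n k a = cs then 1 else 0)"
    if "cs \<in> class_tuples m n k" for cs a
    using index_class_eq_iff_mem[OF _ that] by (auto simp: inv_basis_tensor_def)
  have "invariant_maps m n k = form_of_tensor ?I ` {T \<in> tensors ?I.
      \<forall>a\<in>?I. \<forall>b\<in>?I. index_class m n k a = index_class m n k b \<longrightarrow> T a = T b}"
  proof (rule image_eq_if_bij_betw_iff[OF bij])
    show "invariant_maps m n k \<subseteq> linear_maps (tensors ?I) UNIV"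
      by (auto simp: invariant_maps_def)
    fix T :: "index \<Rightarrow> real" assume "T \<in> tensors ?I"
    \<comment> \<open>Two indices with the same label differ by some \<open>p\<close>, so being
      constant on labels is the same as being fixed by every \<open>p\<close>.\<close>
    then show "form_of_tensor ?I T \<in> invariant_maps m n k \<longleftrightarrow>
        (\<forall>a\<in>?I. \<forall>b\<in>?I. index_class m n k a = index_class m n k b \<longrightarrow> T a = T b)"
      by (simp add: form_of_tensor_invariant_iff index_class_eq_iff_permute) (metis permute_index_in)
  qed
  note * = orthogonal_basis_indicators[OF finite_tensor_indices index_class_image[symmetric] B
      linear_form_of_tensor bij_betw_imp_inj_on[OF bij] this]
  show ?basis ?dim by (rule *; assumption)+
qed

section \<open>Concatenated indices and the equivariant case\<close>

definition concat_index :: "nat \<Rightarrow> index \<times> index \<Rightarrow> index" where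
  "concat_index m = (\<lambda>(a, b). \<lambda>i\<in>{1..m}. a i @ b i)"

text \<open>Since \<open>map\<close> distributes over \<open>(@)\<close>, the simultaneous action on
  pairs becomes the action on single indices.\<close>

lemma permute_concat_index:
  "permute_index m p (concat_index m (a, b)) = concat_index m (permute_index m p a, permute_index m p b)"
  by (simp add: permute_index_def concat_index_def fun_eq_iff restrict_def)

text \<open>The inverse \<open>?g\<close> cuts the list in component \<open>i\<close> after its
  first \<open>k i\<close> entries.\<close>

lemma bij_betw_concat_index:
  "bij_betw (concat_index m) (tensor_indices m n k \<times> tensor_indices m n l)
     (tensor_indices m n (\<lambda>i. k i + l i))"
proof -
  let ?g = "\<lambda>c. (\<lambda>i\<in>{1..m}. take (k i) (c i), \<lambda>i\<in>{1..m}. drop (k i) (c i))"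
  let ?I = "tensor_indices m n k" and ?J = "tensor_indices m n l"
  let ?K = "tensor_indices m n (\<lambda>i. k i + l i)"
  have arb: "a i = undefined" if "a \<in> tensor_indices m n k" "i \<notin> {1..m}" for a i k
    using that unfolding tensor_indices_def by (rule PiE_arb)
  have len: "length (a i) = k i" "set (a i) \<subseteq> {1..n i}" if "a \<in> tensor_indices m n k" "i \<in> {1..m}" for a i k
    using PiE_mem[OF that[unfolded tensor_indices_def]] by (auto simp: multi_indices_def)
  have memI: "restrict a {1..m} \<in> tensor_indices m n k"
    if "\<And>i. i \<in> {1..m} \<Longrightarrow> length (a i) = k i \<and> set (a i) \<subseteq> {1..n i}" for a k
    unfolding tensor_indices_def using that by (intro restrict_PiE_iff[THEN iffD2]) (auto simp: multi_indices_def)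
  show ?thesis
  proof (rule bij_betw_byWitness[where f' = ?g])
    show "\<forall>z\<in>?I \<times> ?J. ?g (concat_index m z) = z"
    proof
      fix z assume "z \<in> ?I \<times> ?J"
      then obtain a b where ab: "a \<in> ?I" "b \<in> ?J" and z: "z = (a, b)" by blast
      show "?g (concat_index m z) = z"
        unfolding z using arb[OF ab(1)] arb[OF ab(2)] len(1)[OF ab(1)]
        by (simp add: concat_index_def fun_eq_iff restrict_def)
    qed
    show "\<forall>c\<in>?K. concat_index m (?g c) = c"
    proof
      fix c assume "c \<in> ?K"
      from arb[OF this] show "concat_index m (?g c) = c"
        by (auto simp: concat_index_def fun_eq_iff restrict_def)
    qed
    show "concat_index m ` (?I \<times> ?J) \<subseteq> ?K"
    proof (rule image_subsetI)
      fix z assume "z \<in> ?I \<times> ?J"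
      then obtain a b where ab: "a \<in> ?I" "b \<in> ?J" and z: "z = (a, b)" by blast
      show "concat_index m z \<in> ?K"
        unfolding z concat_index_def prod.case using len[OF ab(1)] len[OF ab(2)]
        by (intro memI) auto
    qed
    show "?g ` ?K \<subseteq> ?I \<times> ?J"
    proof (rule image_subsetI)
      fix c assume "c \<in> ?K"
      from len[OF this] show "?g c \<in> ?I \<times> ?J"
        by (intro SigmaI memI) (auto dest!: in_set_takeD in_set_dropD)
    qed
  qed
qed

text \<open>Labelling a pair by the class of its concatenation reduces the claim to orbits of single
  indices with exponents \<open>k i + l i\<close>.\<close>

lemma equivariant_maps_basis:
  shows "orthogonal_basis (class_tuples m n (\<lambda>i. k i + l i)) (equiv_basis_tensor m n k l)
      (tensor_indices m n k \<times> tensor_indices m n l)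
      (map_of_tensor (tensor_indices m n k) (tensor_indices m n l)) (equivariant_maps m n k l)"
      (is ?basis)
    and "dim (equivariant_maps m n k l) = card (class_tuples m n (\<lambda>i. k i + l i))" (is ?dim)
proof -
  let ?I = "tensor_indices m n k" and ?J = "tensor_indices m n l" and ?s = "\<lambda>i. k i + l i"
  let ?c = "\<lambda>z. index_class m n ?s (concat_index m z)"
  note bij = bij_betw_map_of_tensor[OF finite_tensor_indices, of m n k ?J]
  note cbij = bij_betw_concat_index[of m n k l]
  have in_K: "concat_index m z \<in> tensor_indices m n ?s" if "z \<in> ?I \<times> ?J" for z
    using bij_betwE[OF cbij] that by blast
  have B: "equiv_basis_tensor m n k l cs z = (if z \<in> ?I \<times> ?J \<and> ?c z = cs then 1 else 0)"
    if "cs \<in> class_tuples m n ?s" for cs z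
    using index_class_eq_iff_mem[OF in_K that, of z]
    by (cases z) (auto simp: equiv_basis_tensor_def concat_index_def)
  have X: "class_tuples m n ?s = ?c ` (?I \<times> ?J)"
    using index_class_image[of m n ?s] cbij by (simp add: bij_betw_def flip: image_image)
  \<comment> \<open>The same \<open>p\<close> moves both halves, matching the criterion in
    \<open>map_of_tensor_equivariant_iff\<close>.\<close>
  have c_eq_iff: "?c (a, b) = ?c (a', b') \<longleftrightarrow>
      (\<exists>p\<in>perm_tuples m n. a' = permute_index m p a \<and> b' = permute_index m p b)"
    if "a \<in> ?I" "b \<in> ?J" "a' \<in> ?I" "b' \<in> ?J" for a b a' b'
  proof -
    have "concat_index m (a', b') = permute_index m p (concat_index m (a, b)) \<longleftrightarrow>
        a' = permute_index m p a \<and> b' = permute_index m p b" if p: "p \<in> perm_tuples m n" for p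
      unfolding permute_concat_index
      using inj_on_eq_iff[OF bij_betw_imp_inj_on[OF cbij], of "(a', b')" "(permute_index m p a, permute_index m p b)"]
        \<open>a \<in> ?I\<close> \<open>b \<in> ?J\<close> \<open>a' \<in> ?I\<close> \<open>b' \<in> ?J\<close> permute_index_in[OF p] by auto
    then show ?thesis
      using that by (subst index_class_eq_iff_permute) (auto intro!: in_K)
  qed
  have "equivariant_maps m n k l = map_of_tensor ?I ?J ` {T \<in> tensors (?I \<times> ?J).
      \<forall>z\<in>?I \<times> ?J. \<forall>w\<in>?I \<times> ?J. ?c z = ?c w \<longrightarrow> T z = T w}"
  proof (rule image_eq_if_bij_betw_iff[OF bij])
    show "equivariant_maps m n k l \<subseteq> linear_maps (tensors ?I) (tensors ?J)"
      by (auto simp: equivariant_maps_def)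
    fix T :: "index \<times> index \<Rightarrow> real" assume "T \<in> tensors (?I \<times> ?J)"
    then show "map_of_tensor ?I ?J T \<in> equivariant_maps m n k l \<longleftrightarrow>
        (\<forall>z\<in>?I \<times> ?J. \<forall>w\<in>?I \<times> ?J. ?c z = ?c w \<longrightarrow> T z = T w)"
      by (simp add: map_of_tensor_equivariant_iff c_eq_iff) (metis permute_index_in)
  qed
  note * = orthogonal_basis_indicators[OF finite_cartesian_product[OF finite_tensor_indices finite_tensor_indices]
      X B linear_map_of_tensor bij_betw_imp_inj_on[OF bij] this]
  show ?basis ?dim by (rule *; assumption)+
qed

text \<open>The dimensions are the numbers of class tuples. The inequalities in front of the Bell
  number formulas ensure that every partition of the positions occurs as an equality
  pattern.\<close>

theorem theorem3:
  fixes m :: nat and n k l :: "nat \<Rightarrow> nat"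
  assumes "m \<ge> 1"
    and "\<And>i. i \<in> {1..m} \<Longrightarrow> n i \<ge> 1"
    and "\<And>i. i \<in> {1..m} \<Longrightarrow> k i \<ge> 1"
    and "\<And>i. i \<in> {1..m} \<Longrightarrow> l i \<ge> 1"
  shows
    "subspace (invariant_maps m n k)
     \<and> ((\<forall>i\<in>{1..m}. k i \<le> n i) \<longrightarrow> dim (invariant_maps m n k) = (\<Prod>i=1..m. bell (k i)))
     \<and> orthogonal_basis (class_tuples m n k) (inv_basis_tensor m n k)
         (tensor_indices m n k)
         (form_of_tensor (tensor_indices m n k))
         (invariant_maps m n k)
     \<and> subspace (equivariant_maps m n k l)
     \<and> ((\<forall>i\<in>{1..m}. k i + l i \<le> n i) \<longrightarrow>
           dim (equivariant_maps m n k l) = (\<Prod>i=1..m. bell (k i + l i)))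
     \<and> orthogonal_basis (class_tuples m n (\<lambda>i. k i + l i)) (equiv_basis_tensor m n k l)
         (tensor_indices m n k \<times> tensor_indices m n l)
         (map_of_tensor (tensor_indices m n k) (tensor_indices m n l))
         (equivariant_maps m n k l)"
  using invariant_maps_basis[of m n k] equivariant_maps_basis[of m n k l]
  by (simp add: subspace_if_orthogonal_basis card_class_tuples)

end
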